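(* Let $S$ be a sandwich. Then there exist a group subsandwich $T$ and a surjective sandwich homomorphism $\varphi : S \to T$ such that for every $t \in T$ the fibre $\varphi^{-1}(t)$ is a subsandwich of $S$ that is a right zero sandwich.
   Context: A sandwich is a set $S$ with a binary operation, written by juxtaposition $(a,b)\mapsto ab$, satisfying: left distributivity, $(ab)(ac) = a(bc)$ for all $a,b,c$; idempotency, $aa = a$ for all $a$; the left involutary property, $a(ab) = b$ for all $a,b$; left symmetry, if $ab = b$ then $ba = a$, for all $a,b$. A subsandwich is a subset closed under the operation. A sandwich homomorphism is a map $\varphi$ between sandwiches with $\varphi(ab) = \varphi(a)\varphi(b)$ for all $a,b$. The sandwich structure of a group $G$ (with group operation written $a.b$) is the set $G$ with the operation $ab = a.b^{-1}.a$; it is a sandwich. A group subsandwich is a subsandwich of the sandwich structure of some group. A right zero sandwich is a sandwich in which $ab = b$ for all $a,b$. *)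

theory Defs
  imports "HOL-Algebra.Group"
begin

locale sandwich =
  fixes S :: "'a set" and f :: "'a \<Rightarrow> 'a \<Rightarrow> 'a"  (infixl "\<diamondop>" 70)
  assumes closed: "\<lbrakk>a \<in> S; b \<in> S\<rbrakk> \<Longrightarrow> a \<diamondop> b \<in> S"
    and left_distrib: "\<lbrakk>a \<in> S; b \<in> S; c \<in> S\<rbrakk> \<Longrightarrow> (a \<diamondop> b) \<diamondop> (a \<diamondop> c) = a \<diamondop> (b \<diamondop> c)"
    and idem: "a \<in> S \<Longrightarrow> a \<diamondop> a = a"
    and left_invol: "\<lbrakk>a \<in> S; b \<in> S\<rbrakk> \<Longrightarrow> a \<diamondop> (a \<diamondop> b) = b"
    and left_sym: "\<lbrakk>a \<in> S; b \<in> S; a \<diamondop> b = b\<rbrakk> \<Longrightarrow> b \<diamondop> a = a"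

definition subsandwich :: "'a set \<Rightarrow> 'a set \<Rightarrow> ('a \<Rightarrow> 'a \<Rightarrow> 'a) \<Rightarrow> bool" where
  "subsandwich T S f \<longleftrightarrow> sandwich S f \<and> T \<subseteq> S \<and> (\<forall>a\<in>T. \<forall>b\<in>T. f a b \<in> T)"

lemma subsandwich_imp_sandwich:
  assumes "subsandwich T S f"
  shows "sandwich T f"
proof -
  have "sandwich S f" and TS: "\<And>a. a \<in> T \<Longrightarrow> a \<in> S"
    and cl: "\<And>a b. a \<in> T \<Longrightarrow> b \<in> T \<Longrightarrow> f a b \<in> T"
    using assms by (auto simp: subsandwich_def)
  then interpret sandwich S f by simp
  show ?thesis
    by unfold_locales (simp_all add: TS cl left_distrib idem left_invol left_sym)
qed

definition sandwich_hom ::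
  "'a set \<Rightarrow> ('a \<Rightarrow> 'a \<Rightarrow> 'a) \<Rightarrow> 'b set \<Rightarrow> ('b \<Rightarrow> 'b \<Rightarrow> 'b) \<Rightarrow> ('a \<Rightarrow> 'b) set" where
  "sandwich_hom S f T g =
    {\<phi>. \<phi> \<in> S \<rightarrow> T \<and> (\<forall>a\<in>S. \<forall>b\<in>S. \<phi> (f a b) = g (\<phi> a) (\<phi> b))}"

definition group_op :: "('g, 'm) monoid_scheme \<Rightarrow> 'g \<Rightarrow> 'g \<Rightarrow> 'g" where
  "group_op G a b = a \<otimes>\<^bsub>G\<^esub> inv\<^bsub>G\<^esub> b \<otimes>\<^bsub>G\<^esub> a"

lemma (in group) sandwich_group_op: "sandwich (carrier G) (group_op G)"
proof -
  have cancel: "x \<otimes> (inv x \<otimes> y) = y" "inv x \<otimes> (x \<otimes> y) = y"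
    if "x \<in> carrier G" "y \<in> carrier G" for x y
    using that by (simp_all flip: m_assoc)
  show ?thesis
  proof
    fix a b c
    assume [simp]: "a \<in> carrier G" "b \<in> carrier G" "c \<in> carrier G"
    show "group_op G (group_op G a b) (group_op G a c) = group_op G a (group_op G b c)"
      by (simp add: group_op_def inv_mult_group m_assoc cancel)
  next
    fix a b
    assume [simp]: "a \<in> carrier G" "b \<in> carrier G" and "group_op G a b = b"
    then have "a \<otimes> inv b \<otimes> a = b"
      by (simp add: group_op_def)
    then have "a \<otimes> inv b = b \<otimes> inv a"
      by (metis \<open>a \<in> carrier G\<close> \<open>b \<in> carrier G\<close> inv_closed inv_solve_right m_closed)
    then show "group_op G b a = a"
      by (metis \<open>a \<in> carrier G\<close> \<open>b \<in> carrier G\<close> group_op_def inv_closed inv_solve_right m_closed)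
  qed (simp_all add: group_op_def inv_mult_group m_assoc cancel)
qed

definition group_subsandwich :: "'g set \<Rightarrow> ('g, 'm) monoid_scheme \<Rightarrow> bool" where
  "group_subsandwich T G \<longleftrightarrow> group G \<and> subsandwich T (carrier G) (group_op G)"

definition right_zero_sandwich :: "'a set \<Rightarrow> ('a \<Rightarrow> 'a \<Rightarrow> 'a) \<Rightarrow> bool" where
  "right_zero_sandwich S f \<longleftrightarrow> sandwich S f \<and> (\<forall>a\<in>S. \<forall>b\<in>S. f a b = b)"

text \<open>
  HOL cannot quantify existentially over types, so ``there is a group'' needs a fixed type of
  group elements. The type below is large enough to lose nothing: a group generated by the
  image of a map from a set of elements of type \<open>'a\<close> is a quotient of the free group on
  these elements, and its members are then sets of words in letters \<open>(x, True)\<close> for \<open>x\<close>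
  and \<open>(x, False)\<close> for the inverse of \<open>x\<close>.
\<close>

type_synonym 'a word_class = "('a \<times> bool) list set"

end

theory Submission
  imports Defs "HOL-Algebra.Bij" "HOL-Algebra.Weak_Morphisms"
begin

text \<open>
  The homomorphism is the left regular representation, sending \<open>a\<close> to the left translation
  \<open>x \<mapsto> ax\<close>. Write \<open>L\<^sub>a\<close> for this translation. The left involutary law says that \<open>L\<^sub>a\<close> is a
  permutation of the sandwich, of order at most two. Substituting \<open>ac\<close> for \<open>c\<close> in the left
  distributive law and cancelling \<open>a(ac) = c\<close> turns it into \<open>(ab)c = a(b(ac))\<close>, that is
  \<open>L\<^sub>a\<^sub>b = L\<^sub>a L\<^sub>b L\<^sub>a\<close>. Since \<open>L\<^sub>b\<close> is its own inverse, this is the sandwich operation of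
  \<open>L\<^sub>a\<close> and \<open>L\<^sub>b\<close> in the symmetric group (\<open>left_translation_hom\<close>).
  If \<open>L\<^sub>a = L\<^sub>b\<close>, then \<open>ab = bb = b\<close> by idempotency (\<open>left_mult_absorbs_if_left_translation_eq\<close>);
  hence every fibre is a right zero sandwich.

  The symmetric group has functions as its elements. To get a group whose elements are sets
  of words, each function is coded by its graph (\<open>graph_words\<close>) and the group structure is
  carried along this injection.
\<close>

lemma (in group) image_group_of_inj_on:
  assumes "inj_on h (carrier G)"
  shows "group_hom G (image_group h G) h"
proof (rule weak_group_morphism_group_hom)
  show "weak_group_morphism h {\<one>} G"
  proof (rule weak_group_morphismsI)
    show "{\<one>} \<lhd> G"
      by (rule one_is_normal)
    show "h a = h b \<longleftrightarrow> a \<otimes> inv b \<in> {\<one>}" if "a \<in> carrier G" "b \<in> carrier G" for a b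
      using that assms by (metis inj_onD inv_closed inv_equality inv_inv r_inv singleton_iff)
  qed
qed

lemma (in group_hom) group_op_hom:
  assumes "a \<in> carrier G" "b \<in> carrier G"
  shows "h (group_op G a b) = group_op H (h a) (h b)"
  using assms by (simp add: group_op_def)

context sandwich
begin

definition left_translation :: "'a \<Rightarrow> 'a \<Rightarrow> 'a" where
  "left_translation a = (\<lambda>x\<in>S. a \<diamondop> x)"

lemma left_translation_in_BijGroup:
  assumes "a \<in> S"
  shows "left_translation a \<in> carrier (BijGroup S)"
proof -
  have "bij_betw (left_translation a) S S"
    using assms by (intro bij_betw_byWitness[where f' = "left_translation a"])
      (auto simp: left_translation_def closed left_invol)
  then show ?thesis
    by (simp add: BijGroup_def Bij_def left_translation_def)
qed

lemma inv_left_translation: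
  assumes "a \<in> S"
  shows "inv\<^bsub>BijGroup S\<^esub> left_translation a = left_translation a"
proof (rule group.inv_equality[OF group_BijGroup])
  show "left_translation a \<otimes>\<^bsub>BijGroup S\<^esub> left_translation a = \<one>\<^bsub>BijGroup S\<^esub>"
    using left_translation_in_BijGroup[OF assms] assms
    by (auto simp: BijGroup_def compose_def left_translation_def closed left_invol
        intro!: restrict_ext)
qed (use assms in \<open>simp_all add: left_translation_in_BijGroup\<close>)

text \<open>
  This is left distributivity with \<open>ac\<close> in place of \<open>c\<close>: on the left-hand side \<open>a(ac)\<close>
  collapses to \<open>c\<close>.
\<close>

lemma left_distrib_conjugation:
  assumes "a \<in> S" "b \<in> S" "c \<in> S"
  shows "(a \<diamondop> b) \<diamondop> c = a \<diamondop> (b \<diamondop> (a \<diamondop> c))"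
  using left_distrib[of a b "a \<diamondop> c"] assms by (simp add: closed left_invol)

lemma left_translation_hom:
  assumes "a \<in> S" "b \<in> S"
  shows "left_translation (a \<diamondop> b)
    = group_op (BijGroup S) (left_translation a) (left_translation b)"
proof -
  have Bij: "left_translation x \<in> Bij S" if "x \<in> S" for x
    using left_translation_in_BijGroup[OF that] by (simp add: BijGroup_def)
  have "left_translation (a \<diamondop> b)
      = compose S (compose S (left_translation a) (left_translation b)) (left_translation a)"
    using assms
    by (auto simp: left_translation_def compose_def closed left_distrib_conjugation
        intro!: restrict_ext)
  then show ?thesis
    using assms by (simp add: group_op_def inv_left_translation)
      (simp add: BijGroup_def Bij compose_Bij)
qed

lemma left_mult_absorbs_if_left_translation_eq:
  assumes "a \<in> S" "b \<in> S" "left_translation a = left_translation b"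
  shows "a \<diamondop> b = b"
proof -
  have "a \<diamondop> b = left_translation a b"
    using assms(2) by (simp add: left_translation_def)
  also have "\<dots> = b"
    using assms by (simp add: left_translation_def idem)
  finally show ?thesis .
qed

end

text \<open>
  A homomorphism maps onto a group subsandwich because its image is closed under the
  operation. Fibres are subsandwiches as soon as any two of their members satisfy \<open>xy = y\<close>,
  since then the product of \<open>x\<close> and \<open>y\<close> is the member \<open>y\<close> itself.
\<close>

lemma (in sandwich) image_and_fibres_of_hom_to_group:
  assumes G: "group G" and \<phi>: "\<phi> \<in> sandwich_hom S f (carrier G) (group_op G)"
    and absorb: "\<And>a b. \<lbrakk>a \<in> S; b \<in> S; \<phi> a = \<phi> b\<rbrakk> \<Longrightarrow> a \<diamondop> b = b"
  shows "group_subsandwich (\<phi> ` S) G"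
    and "\<phi> \<in> sandwich_hom S f (\<phi> ` S) (group_op G)"
    and "subsandwich {x \<in> S. \<phi> x = t} S f"
    and "right_zero_sandwich {x \<in> S. \<phi> x = t} f"
proof -
  have hom: "group_op G (\<phi> a) (\<phi> b) = \<phi> (a \<diamondop> b)" if "a \<in> S" "b \<in> S" for a b
    using \<phi> that by (simp add: sandwich_hom_def)
  have "\<phi> ` S \<subseteq> carrier G"
    using \<phi> by (auto simp: sandwich_hom_def)
  then show "group_subsandwich (\<phi> ` S) G"
    using G group.sandwich_group_op[OF G]
    by (auto simp: group_subsandwich_def subsandwich_def hom closed)
  show "\<phi> \<in> sandwich_hom S f (\<phi> ` S) (group_op G)"
    by (simp add: sandwich_hom_def hom)
  show fibre: "subsandwich {x \<in> S. \<phi> x = t} S f"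
    using sandwich_axioms by (auto simp: subsandwich_def absorb)
  show "right_zero_sandwich {x \<in> S. \<phi> x = t} f"
    using subsandwich_imp_sandwich[OF fibre] by (auto simp: right_zero_sandwich_def absorb)
qed

text \<open>
  Each pair \<open>(x, g x)\<close> of the graph of \<open>g\<close> is written as a word of two positive letters. The
  words serve only as a code, and multiplication of the coded functions is not concatenation.
\<close>

definition graph_words :: "('a \<Rightarrow> 'a) \<Rightarrow> 'a word_class" where
  "graph_words g = range (\<lambda>x. [(x, True), (g x, True)])"

lemma inj_graph_words: "inj graph_words"
proof (rule injI, rule ext)
  fix g h :: "'a \<Rightarrow> 'a" and x
  assume "graph_words g = graph_words h"
  then have "[(x, True), (g x, True)] \<in> graph_words h"
    by (auto simp: graph_words_def)
  then show "g x = h x"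
    by (auto simp: graph_words_def)
qed

theorem theorem3p5:
  fixes S :: "'a set" and f :: "'a \<Rightarrow> 'a \<Rightarrow> 'a"
  assumes "sandwich S f"
  shows "\<exists>(G :: 'a word_class monoid) T \<phi>.
    group_subsandwich T G \<and>
    \<phi> \<in> sandwich_hom S f T (group_op G) \<and> \<phi> ` S = T \<and>
    (\<forall>t\<in>T. subsandwich {x \<in> S. \<phi> x = t} S f \<and>
            right_zero_sandwich {x \<in> S. \<phi> x = t} f)"
proof -
  interpret sandwich S f by (rule assms)
  define G where "G = image_group graph_words (BijGroup S)"
  define \<phi> where "\<phi> a = graph_words (left_translation a)" for a
  interpret enc: group_hom "BijGroup S" G graph_words
    unfolding G_def
    by (intro group.image_group_of_inj_on group_BijGroup inj_on_subset[OF inj_graph_words]) simp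
  have "\<phi> \<in> sandwich_hom S f (carrier G) (group_op G)"
    by (auto simp: sandwich_hom_def \<phi>_def left_translation_hom enc.group_op_hom
        left_translation_in_BijGroup)
  moreover have "f a b = b" if "a \<in> S" "b \<in> S" "\<phi> a = \<phi> b" for a b
    using that injD[OF inj_graph_words]
    by (metis \<phi>_def left_mult_absorbs_if_left_translation_eq)
  ultimately show ?thesis
    using image_and_fibres_of_hom_to_group[OF enc.H.is_group, of \<phi>] by blast
qed

end
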